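(* Let $X$ be a non-empty, open and convex subset of $\mathbb{R}^n$. Then every concave (or convex) function $f:X\to\mathbb{R}$ is linearly continuous.
   Context: A straight line in $X$ is the intersection with $X$ of a one-dimensional affine subspace of $\mathbb{R}^n$. A function $f:X\to\mathbb{R}$ is linearly continuous if its restriction to every straight line in $X$ is continuous. *)

theory Defs
  imports "HOL-Analysis.Analysis"
begin

(* A function f : X -> R is represented by a total function; only its values on X matter. *)

definition straight_line_in :: "(real ^ 'n) set \<Rightarrow> (real ^ 'n) set \<Rightarrow> bool" where
  "straight_line_in X S \<longleftrightarrow> (\<exists>L. affine L \<and> aff_dim L = 1 \<and> S = L \<inter> X)"

definition linearly_continuous_on :: "(real ^ 'n) set \<Rightarrow> (real ^ 'n \<Rightarrow> real) \<Rightarrow> bool" where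
  "linearly_continuous_on X f \<longleftrightarrow> (\<forall>S. straight_line_in X S \<longrightarrow> continuous_on S f)"

end

theory Submission
  imports Defs
begin

text \<open>A convex function on an open subset of a finite-dimensional space is continuous
  (\<open>convex_on_continuous\<close>); for concave \<open>f\<close> this applies to
  \<open>-f\<close>. So \<open>f\<close> is jointly continuous on \<open>X\<close>, which is
  stronger than continuity along lines.\<close>

theorem proposition1:
  fixes X :: "(real ^ 'n) set" and f :: "real ^ 'n \<Rightarrow> real"
  assumes "X \<noteq> {}" and "open X" and "convex X"
    and "concave_on X f \<or> convex_on X f"
  shows "linearly_continuous_on X f"
proof -
  have "continuous_on X f"
    using assms(4)
  proof
    assume "concave_on X f"
    then have "continuous_on X (\<lambda>x. - f x)"
      unfolding concave_on_def using \<open>open X\<close> by (rule convex_on_continuous[rotated])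
    then show ?thesis
      \<comment> \<open>Negating a second time recovers \<open>f\<close>.\<close>
      using continuous_on_minus by fastforce
  next
    assume "convex_on X f"
    with \<open>open X\<close> show ?thesis
      by (rule convex_on_continuous)
  qed
  then show ?thesis
    unfolding linearly_continuous_on_def straight_line_in_def
    \<comment> \<open>Each straight line in \<open>X\<close> has the form
      \<open>L \<inter> X\<close>, a subset of \<open>X\<close>, so continuity restricts to
      it.\<close>
    by (auto intro: continuous_on_subset)
qed

end
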